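(* Let $m\in\mathbb{N}$. If $C\subset\mathbb{R}^n$ is compact, and if there exists an open convex neighbourhood $U$ of $C$ such that $f:U\to\mathbb{R}$ is of class $C^m$ and convex, then there exists a convex function $F\in C^{m}(\mathbb{R}^n)$ such that $F=f$ on $C$.
   Context: $\mathbb{N}=\{1,2,3,\ldots\}$. *)

theory Defs
  imports "HOL-Analysis.Analysis"
begin

(* Class C^k on an open set U: f is continuous for k = 0; f is C^(k+1) iff f is (Frechet)
   differentiable on U and x |-> Df(x) v is C^k on U for every fixed direction v. In finite
   dimension this says that Df, as a map into the space of linear maps, is C^k. On an open U
   the predicate depends only on the values of f on U, so a function U -> R may be given by
   any total function extending it. *)
primrec Ck_on :: "nat \<Rightarrow> ('a::euclidean_space \<Rightarrow> 'b::real_normed_vector) \<Rightarrow> 'a set \<Rightarrow> bool"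
where
  "Ck_on 0 f U \<longleftrightarrow> continuous_on U f"
| "Ck_on (Suc k) f U \<longleftrightarrow>
     f differentiable_on U \<and> (\<forall>v. Ck_on k (\<lambda>x. frechet_derivative f (at x) v) U)"

end

theory Submission
  imports Defs
begin

text \<open>
Replacing \<open>C\<close> by its convex hull \<open>K\<close>, which is still a compact subset of the convex
set \<open>U\<close>, take an open \<open>V\<close> with \<open>K \<subseteq> V\<close> and \<open>closure V\<close> a compact subset of \<open>U\<close>. If \<open>g\<close> is a
\<open>C\<^sup>m\<close> convex function on the whole space that lies below \<open>f\<close> on \<open>K\<close> and above \<open>f\<close> on the frontier of
\<open>V\<close>, then the maximum of \<open>f\<close> and \<open>g\<close> on \<open>V\<close>, continued by \<open>g\<close> outside \<open>V\<close>, is convex and equals \<open>f\<close>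
on \<open>K\<close>. To keep the smoothness, the maximum \<open>f + max 0 (g - f)\<close> is replaced by
\<open>f + h (g - f)\<close>, where \<open>h\<close> is a smoothed ramp: a convex \<open>C\<^sup>m\<close> function with slopes in \<open>[0, 1]\<close> which is
\<open>0\<close> on the negative half-line and \<open>t - c\<close> for \<open>t \<ge> m\<close>. Where \<open>g - f \<ge> m\<close> the combination is exactly
\<open>g - c\<close>, so it continues smoothly by \<open>g - c\<close> past the frontier of \<open>V\<close>.

Three ingredients carry the proof.

The ramp \<open>h\<close> is the \<open>m\<close>-fold backward difference of \<open>t\<^sub>+\<^sup>m\<^sup>+\<^sup>1 / (m+1)!\<close>, that is, the convolution
of \<open>t\<^sub>+\<close> with a B-spline. Its properties follow by induction on \<open>m\<close>, since the derivative of one ramp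
is the backward difference of the preceding one (\<open>smooth_ramp_deriv\<close>).

The function \<open>g\<close> is \<open>A \<phi> - B\<close> for large constants, where \<open>\<phi>\<close> is convex, vanishes on \<open>K\<close> and is positive
on the frontier of \<open>V\<close>. Hyperplanes separate \<open>K\<close> from each frontier point, by compactness finitely many
of them suffice, and \<open>\<phi>\<close> is, up to a factor, the sum of the \<open>(m+1)\<close>-st powers of the positive parts of the corresponding
affine functions (\<open>smooth_convex_vanishing_on_convex_pos_on_compact\<close>).

Convexity of the glued function is a local matter (\<open>convex_on_if_locally_midpoint_convex\<close>). Inside \<open>V\<close>
it holds because \<open>(x, y) \<mapsto> x + h (y - x)\<close> is convex and nondecreasing in both arguments. Outside \<open>V\<close>
it holds because the glued function there equals the convex function \<open>g - c\<close>, which it dominates everywhere,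
because \<open>h t \<ge> t - c\<close> for every \<open>t\<close>.
\<close>

section \<open>Calculus of functions of class C^k\<close>

text \<open>\<^const>\<open>frechet_derivative\<close> is a choice among all candidates, so agreement on \<open>U\<close> transfers to it
only because derivatives at interior points are unique.\<close>
lemma Ck_on_cong:
  assumes "open U" "\<And>x. x \<in> U \<Longrightarrow> f x = g x"
  shows "Ck_on k f U \<longleftrightarrow> Ck_on k g U"
proof -
  have one_way: "Ck_on k g U" if "\<And>x. x \<in> U \<Longrightarrow> f x = g x" "Ck_on k f U" for k f g
    using that
  proof (induction k arbitrary: f g)
    case 0
    then show ?case using continuous_on_cong by force
  next
    case (Suc k)
    have d: "(g has_derivative frechet_derivative f (at x)) (at x)" if "x \<in> U" for x
    proof (rule has_derivative_transform_within_open[OF _ \<open>open U\<close> that])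
      show "(f has_derivative frechet_derivative f (at x)) (at x)"
        using Suc.prems(2) that \<open>open U\<close>
        by (metis Ck_on.simps(2) differentiable_on_eq_differentiable_at frechet_derivative_works)
    qed (use Suc.prems(1) in auto)
    have "g differentiable_on U"
      using d \<open>open U\<close> differentiable_on_eq_differentiable_at differentiable_def by blast
    moreover have "Ck_on k (\<lambda>x. frechet_derivative g (at x) v) U" for v
    proof (rule Suc.IH)
      show "frechet_derivative f (at x) v = frechet_derivative g (at x) v" if "x \<in> U" for x
        using frechet_derivative_at[OF d[OF that]] by simp
      show "Ck_on k (\<lambda>x. frechet_derivative f (at x) v) U"
        using Suc.prems(2) by simp
    qed
    ultimately show ?case by simp
  qed
  show ?thesis using one_way[of f g] one_way[of g f] assms(2) by metis
qed

text \<open>Lets smoothness be read off an explicit formula \<open>D\<close> for the derivative.\<close>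
lemma Ck_on_SucI:
  assumes "open U" "\<And>x. x \<in> U \<Longrightarrow> (f has_derivative D x) (at x)"
    and "\<And>v. Ck_on k (\<lambda>x. D x v) U"
  shows "Ck_on (Suc k) f U"
proof -
  have "f differentiable_on U"
    using assms(1,2) differentiable_on_eq_differentiable_at differentiable_def by blast
  moreover have "Ck_on k (\<lambda>x. frechet_derivative f (at x) v) U" for v
    using assms(3)[of v] Ck_on_cong[OF assms(1), of "\<lambda>x. D x v"] frechet_derivative_at[OF assms(2)]
    by (metis (no_types, lifting))
  ultimately show ?thesis by simp
qed

lemma Ck_on_SucD:
  assumes "open U" "Ck_on (Suc k) f U" "x \<in> U"
  shows "(f has_derivative frechet_derivative f (at x)) (at x)"
  using assms
  by (metis Ck_on.simps(2) differentiable_on_eq_differentiable_at frechet_derivative_works)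

lemma Ck_on_Suc_imp: "Ck_on (Suc k) f U \<Longrightarrow> Ck_on k f U"
proof (induction k arbitrary: f)
  case 0
  then show ?case by (simp add: differentiable_imp_continuous_on)
next
  case (Suc k)
  then show ?case by (metis Ck_on.simps(2))
qed

lemma Ck_on_imp_continuous_on: "Ck_on k f U \<Longrightarrow> continuous_on U f"
  by (induction k) (auto simp: differentiable_imp_continuous_on)

lemma Ck_on_subset: "Ck_on k f U \<Longrightarrow> V \<subseteq> U \<Longrightarrow> open U \<Longrightarrow> Ck_on k f V"
proof (induction k arbitrary: f)
  case 0
  then show ?case using continuous_on_subset by auto
next
  case (Suc k)
  then show ?case by (auto intro: differentiable_on_subset)
qed

text \<open>Openness of both sets matters: for sets that merely cover, a function can be smooth on each
piece and have a jump between them.\<close>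
lemma Ck_on_Un:
  "Ck_on k f U \<Longrightarrow> Ck_on k f V \<Longrightarrow> open U \<Longrightarrow> open V \<Longrightarrow> Ck_on k f (U \<union> V)"
proof (induction k arbitrary: f)
  case 0
  then show ?case by (simp add: continuous_on_open_Un)
next
  case (Suc k)
  then show ?case
    by (auto simp: differentiable_on_eq_differentiable_at open_Un)
qed

lemma Ck_on_const: "open U \<Longrightarrow> Ck_on k (\<lambda>_. c) U"
proof (induction k arbitrary: c)
  case (Suc k)
  show ?case
    by (rule Ck_on_SucI[where D = "\<lambda>_ _. 0"]) (use Suc in auto)
qed auto

lemma Ck_on_bounded_linear: "bounded_linear L \<Longrightarrow> open U \<Longrightarrow> Ck_on k L U"
proof (cases k)
  case (Suc j)
  assume "bounded_linear L" "open U"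
  then show ?thesis unfolding Suc
    by (intro Ck_on_SucI[where D = "\<lambda>_. L"]) (auto intro: Ck_on_const bounded_linear_imp_has_derivative)
qed (auto simp: linear_continuous_on)

lemma Ck_on_add:
  assumes "open U"
  shows "Ck_on k f U \<Longrightarrow> Ck_on k g U \<Longrightarrow> Ck_on k (\<lambda>x. f x + g x) U"
proof (induction k arbitrary: f g)
  case 0
  then show ?case by (simp add: continuous_on_add)
next
  case (Suc k)
  show ?case
  proof (rule Ck_on_SucI[OF assms])
    show "((\<lambda>x. f x + g x) has_derivative
        (\<lambda>v. frechet_derivative f (at x) v + frechet_derivative g (at x) v)) (at x)"
      if "x \<in> U" for x
      using Suc.prems that by (intro has_derivative_add Ck_on_SucD[OF assms])
  qed (use Suc in auto)
qed

text \<open>The product rule pairs a derivative, which has lost one degree of smoothness, with an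
undifferentiated factor, which has one to spare; so both products fall under the induction
hypothesis.\<close>
lemma Ck_on_mult:
  fixes f g :: "'a::euclidean_space \<Rightarrow> real"
  assumes "open U"
  shows "Ck_on k f U \<Longrightarrow> Ck_on k g U \<Longrightarrow> Ck_on k (\<lambda>x. f x * g x) U"
proof (induction k arbitrary: f g)
  case 0
  then show ?case by (simp add: continuous_on_mult)
next
  case (Suc k)
  show ?case
  proof (rule Ck_on_SucI[OF assms])
    show "((\<lambda>x. f x * g x) has_derivative
        (\<lambda>v. f x * frechet_derivative g (at x) v + frechet_derivative f (at x) v * g x)) (at x)"
      if "x \<in> U" for x
      using Suc.prems that by (intro has_derivative_mult Ck_on_SucD[OF assms])
    show "Ck_on k (\<lambda>x. f x * frechet_derivative g (at x) v
        + frechet_derivative f (at x) v * g x) U" for v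
      using Suc.prems Ck_on_Suc_imp by (intro Ck_on_add[OF assms] Suc.IH) auto
  qed
qed

lemma Ck_on_cmult:
  fixes f :: "'a::euclidean_space \<Rightarrow> real"
  shows "open U \<Longrightarrow> Ck_on k f U \<Longrightarrow> Ck_on k (\<lambda>x. c * f x) U"
  by (intro Ck_on_mult Ck_on_const)

lemma Ck_on_diff:
  fixes f g :: "'a::euclidean_space \<Rightarrow> real"
  shows "open U \<Longrightarrow> Ck_on k f U \<Longrightarrow> Ck_on k g U \<Longrightarrow> Ck_on k (\<lambda>x. f x - g x) U"
  using Ck_on_add[of U k f "\<lambda>x. -1 * g x"] Ck_on_cmult[of U k g "-1"] by simp

lemma Ck_on_sum:
  fixes f :: "'i \<Rightarrow> 'a::euclidean_space \<Rightarrow> real"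
  assumes "open U" "\<And>i. i \<in> I \<Longrightarrow> Ck_on k (f i) U"
  shows "Ck_on k (\<lambda>x. \<Sum>i\<in>I. f i x) U"
  using assms
  by (induction I rule: infinite_finite_induct) (auto intro: Ck_on_add Ck_on_const)

text \<open>The induction runs over \<open>h\<close> and \<open>f\<close> together, since the chain rule produces the composition of \<open>h'\<close>
with \<open>f\<close>. The derivative of a function of one real variable is multiplication by its value on the unit
vector \<open>1\<close>.\<close>
lemma Ck_on_compose:
  fixes f :: "'a::euclidean_space \<Rightarrow> real" and h :: "real \<Rightarrow> real"
  assumes "open U"
  shows "Ck_on k h UNIV \<Longrightarrow> Ck_on k f U \<Longrightarrow> Ck_on k (\<lambda>x. h (f x)) U"
proof (induction k arbitrary: f h)
  case 0
  then show ?case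
    using continuous_on_compose2 by fastforce
next
  case (Suc k)
  let ?h' = "\<lambda>t. frechet_derivative h (at t) 1"
  show ?case
  proof (rule Ck_on_SucI[OF assms])
    fix x assume "x \<in> U"
    have h: "(h has_derivative frechet_derivative h (at (f x))) (at (f x))"
      using Suc.prems by (intro Ck_on_SucD[of UNIV]) auto
    have "frechet_derivative h (at (f x)) = (\<lambda>s. ?h' (f x) * s)"
    proof
      show "frechet_derivative h (at (f x)) s = ?h' (f x) * s" for s
        using linear_scale[OF has_derivative_linear[OF h], of s 1] by (simp add: mult.commute)
    qed
    with h have "(h has_derivative (\<lambda>s. ?h' (f x) * s)) (at (f x))"
      by (rule back_subst[where P = "\<lambda>D. (h has_derivative D) (at (f x))"])
    from has_derivative_compose[OF Ck_on_SucD[OF assms Suc.prems(2) \<open>x \<in> U\<close>] this] show "((\<lambda>x. h (f x)) has_derivative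
        (\<lambda>v. ?h' (f x) * frechet_derivative f (at x) v)) (at x)"
      by simp
  next
    fix v
    show "Ck_on k (\<lambda>x. ?h' (f x) * frechet_derivative f (at x) v) U"
    proof (rule Ck_on_mult[OF assms])
      show "Ck_on k (\<lambda>x. ?h' (f x)) U"
        using Suc.prems(1) Ck_on_Suc_imp[OF Suc.prems(2)]
        by (intro Suc.IH[where h = ?h']) auto
      show "Ck_on k (\<lambda>x. frechet_derivative f (at x) v) U"
        using Suc.prems(2) by simp
    qed
  qed
qed

lemma Ck_on_Suc_real:
  fixes h :: "real \<Rightarrow> real"
  assumes "\<And>t. (h has_real_derivative h' t) (at t)" "Ck_on k h' UNIV"
  shows "Ck_on (Suc k) h UNIV"
proof (rule Ck_on_SucI[where D = "\<lambda>t v. h' t * v"])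
  show "Ck_on k (\<lambda>t. h' t * v) UNIV" for v
    using assms(2) by (intro Ck_on_mult Ck_on_const) auto
qed (use assms(1) in \<open>auto simp: has_field_derivative_def\<close>)

section \<open>Truncated powers\<close>

definition trunc_power :: "nat \<Rightarrow> real \<Rightarrow> real"
  where "trunc_power k t = max t 0 ^ k / fact k"

text \<open>The factorial in the definition makes the derivative of one truncated power exactly the preceding
one. At the origin the difference quotient is, up to a constant, again a truncated power of positive
degree, so it tends to zero; this is where the exponent has to be at least two.\<close>
lemma trunc_power_deriv:
  "(trunc_power (Suc (Suc k)) has_real_derivative trunc_power (Suc k) t) (at t)"
proof -
  consider "t < 0" | "t = 0" | "t > 0" by linarith
  then show ?thesis
  proof cases
    case 1
    have "((\<lambda>_. 0) has_real_derivative trunc_power (Suc k) t) (at t)"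
      using 1 by (simp add: trunc_power_def)
    then show ?thesis
      by (rule has_field_derivative_transform_within_open[where S = "{..<0}"])
         (use 1 in \<open>auto simp: trunc_power_def\<close>)
  next
    case 2
    let ?q = "\<lambda>s::real. max s 0 ^ Suc k / fact (Suc (Suc k))"
    have "isCont ?q 0" by (intro continuous_intros) auto
    then have "?q \<midarrow>0\<rightarrow> 0" by (simp add: isCont_def)
    moreover have "\<forall>\<^sub>F s in at 0. ?q s = trunc_power (Suc (Suc k)) s / s"
      by (auto simp: trunc_power_def eventually_at_filter max_def)
    ultimately have "(\<lambda>s. trunc_power (Suc (Suc k)) s / s) \<midarrow>0\<rightarrow> 0"
      using tendsto_cong by fast
    then show ?thesis
      unfolding 2 DERIV_def by (simp add: trunc_power_def)
  next
    case 3
    have "((\<lambda>s. s ^ Suc (Suc k) / fact (Suc (Suc k))) has_real_derivative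
        real (Suc (Suc k)) * t ^ Suc k / fact (Suc (Suc k))) (at t)"
      using DERIV_cdivide[OF DERIV_pow[of "Suc (Suc k)" t], of "fact (Suc (Suc k))"]
      by (simp only: diff_Suc_1 diff_Suc_Suc diff_zero)
    moreover have "real (Suc (Suc k)) * t ^ Suc k / fact (Suc (Suc k)) = trunc_power (Suc k) t"
      using 3 by (simp add: trunc_power_def fact_Suc[of "Suc k"] del: of_nat_Suc fact_Suc power_Suc)
    ultimately have "((\<lambda>s. s ^ Suc (Suc k) / fact (Suc (Suc k))) has_real_derivative
        trunc_power (Suc k) t) (at t)" by simp
    then show ?thesis
      by (rule has_field_derivative_transform_within_open[where S = "{0<..}"])
         (use 3 in \<open>auto simp: trunc_power_def\<close>)
  qed
qed

lemma mono_trunc_power: "mono (trunc_power k)"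
  by (auto simp: trunc_power_def intro!: monoI divide_right_mono power_mono)

lemma Ck_on_trunc_power: "Ck_on k (trunc_power (Suc k)) UNIV"
proof (induction k)
  case 0
  show ?case by (auto simp: trunc_power_def intro!: continuous_intros)
next
  case (Suc k)
  show ?case by (rule Ck_on_Suc_real[OF trunc_power_deriv Suc])
qed

lemma convex_on_trunc_power: "convex_on UNIV (trunc_power (Suc k))"
proof (cases k)
  case 0
  show ?thesis unfolding 0
  proof (rule convex_onI)
    fix t x y :: real assume "0 < t" "t < 1"
    then have "(1-t) * x \<le> (1-t) * max x 0" "t * y \<le> t * max y 0"
      "0 \<le> (1-t) * max x 0" "0 \<le> t * max y 0"
      by (auto intro!: mult_left_mono mult_nonneg_nonneg)
    then show "trunc_power (Suc 0) ((1-t) *\<^sub>R x + t *\<^sub>R y)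
        \<le> (1-t) * trunc_power (Suc 0) x + t * trunc_power (Suc 0) y"
      by (simp add: trunc_power_def)
  qed auto
next
  case (Suc j)
  show ?thesis unfolding Suc
    by (rule convex_on_realI[OF _ trunc_power_deriv])
       (auto intro: monoD[OF mono_trunc_power])
qed

section \<open>A smooth convex ramp\<close>

definition backward_diff :: "(real \<Rightarrow> real) \<Rightarrow> real \<Rightarrow> real"
  where "backward_diff q t = q t - q (t - 1)"

text \<open>The backward difference of an antiderivative of \<open>q\<close> is the average of \<open>q\<close> over \<open>[t - 1, t]\<close>. Hence
\<open>m\<close> differences of the \<open>m\<close>-fold antiderivative of \<open>t\<^sub>+\<close> average \<open>t\<^sub>+\<close> \<open>m\<close> times, and each averaging
step gains one degree of smoothness.\<close>
definition smooth_ramp :: "nat \<Rightarrow> real \<Rightarrow> real"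
  where "smooth_ramp m = (backward_diff ^^ m) (trunc_power (Suc m))"

text \<open>The recursion behind all properties of the ramp: differentiation commutes with backward
differences and lowers the degree of the truncated power, leaving one difference too many.\<close>
lemma smooth_ramp_deriv:
  "(smooth_ramp (Suc m) has_real_derivative backward_diff (smooth_ramp m) t) (at t)"
proof -
  have "((backward_diff ^^ j) (trunc_power (Suc (Suc m))) has_real_derivative
      (backward_diff ^^ j) (trunc_power (Suc m)) t) (at t)" for j t
  proof (induction j arbitrary: t)
    case 0
    show ?case by (simp add: trunc_power_deriv)
  next
    case (Suc j)
    have "((\<lambda>t. (backward_diff ^^ j) (trunc_power (Suc (Suc m))) (t - 1)) has_real_derivative
        (backward_diff ^^ j) (trunc_power (Suc m)) (t - 1)) (at t)"
      using Suc[of "t - 1"] DERIV_shift[of _ _ t "-1"] by simp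
    from DERIV_diff[OF Suc this] show ?case
      by (simp add: backward_diff_def[abs_def])
  qed
  from this[of "Suc m"] show ?thesis
    by (simp add: smooth_ramp_def)
qed

lemma Ck_on_smooth_ramp: "Ck_on m (smooth_ramp m) UNIV"
proof (induction m)
  case 0
  show ?case using Ck_on_trunc_power[of 0] by (simp add: smooth_ramp_def)
next
  case (Suc m)
  have "Ck_on m (\<lambda>t. smooth_ramp m t - smooth_ramp m (t - 1)) UNIV"
  proof (rule Ck_on_diff[OF open_UNIV Suc])
    have "Ck_on m (\<lambda>t::real. t - 1) UNIV"
      by (rule Ck_on_diff[OF open_UNIV Ck_on_bounded_linear[OF bounded_linear_ident open_UNIV]
            Ck_on_const[OF open_UNIV]])
    then show "Ck_on m (\<lambda>t. smooth_ramp m (t - 1)) UNIV"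
      by (rule Ck_on_compose[OF open_UNIV Suc])
  qed
  then show ?case
    by (intro Ck_on_Suc_real[OF smooth_ramp_deriv]) (simp add: backward_diff_def[abs_def])
qed

lemma smooth_ramp_eq_0: "t \<le> 0 \<Longrightarrow> smooth_ramp m t = 0"
proof -
  have "t \<le> 0 \<Longrightarrow> (backward_diff ^^ j) (trunc_power (Suc m)) t = 0" for j
    by (induction j arbitrary: t) (auto simp: trunc_power_def backward_diff_def)
  then show "t \<le> 0 \<Longrightarrow> smooth_ramp m t = 0" by (simp add: smooth_ramp_def)
qed

text \<open>The derivative at \<open>t\<close> is the increment over \<open>[t - 1, t]\<close> of the preceding ramp, which by induction
lies between \<open>0\<close> and the length \<open>1\<close> of that interval.\<close>
lemma smooth_ramp_mono_and_lipschitz: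
  "s \<le> t \<Longrightarrow> 0 \<le> smooth_ramp m t - smooth_ramp m s \<and> smooth_ramp m t - smooth_ramp m s \<le> t - s"
proof (induction m arbitrary: s t)
  case 0
  then show ?case by (auto simp: smooth_ramp_def trunc_power_def)
next
  case (Suc m)
  have slope: "0 \<le> backward_diff (smooth_ramp m) x" "backward_diff (smooth_ramp m) x \<le> 1" for x
    using Suc.IH[of "x - 1" x] by (simp_all add: backward_diff_def)
  have "smooth_ramp (Suc m) s \<le> smooth_ramp (Suc m) t"
    by (rule DERIV_nonneg_imp_nondecreasing[OF Suc.prems]) (use slope smooth_ramp_deriv in blast)
  moreover have "s - smooth_ramp (Suc m) s \<le> t - smooth_ramp (Suc m) t"
  proof (rule DERIV_nonneg_imp_nondecreasing[OF Suc.prems])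
    fix x
    have "((\<lambda>x. x - smooth_ramp (Suc m) x) has_real_derivative
        1 - backward_diff (smooth_ramp m) x) (at x)"
      by (intro derivative_intros smooth_ramp_deriv)
    then show "\<exists>y. ((\<lambda>x. x - smooth_ramp (Suc m) x) has_real_derivative y) (at x) \<and> 0 \<le> y"
      using slope(2)[of x] by (intro exI[of _ "1 - backward_diff (smooth_ramp m) x"]) simp
  qed
  ultimately show ?case by simp
qed

text \<open>Increments of a convex function over intervals of a fixed length increase to the right.\<close>
lemma mono_backward_diff:
  assumes "convex_on UNIV q"
  shows "mono (backward_diff q)"
proof
  fix x y :: real assume "x \<le> y"
  \<comment> \<open>The points \<open>x\<close> and \<open>y - 1\<close> lie at distance \<open>1\<close> from the two ends of \<open>[x - 1, y]\<close>; they are the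
    convex combinations of the ends with weights \<open>(1 - l, l)\<close> and \<open>(l, 1 - l)\<close>, so adding the two
    convexity inequalities cancels the weights.\<close>
  define l where "l = 1 / (y - x + 1)"
  have l: "0 \<le> l" "l \<le> 1" and eq: "l * (y - x + 1) = 1"
    using \<open>x \<le> y\<close> by (auto simp: l_def)
  have "(1 - l) * (x - 1) + l * y = x" "l * (x - 1) + (1 - l) * y = y - 1"
    using eq by (auto simp: algebra_simps)
  then have "q x \<le> (1 - l) * q (x - 1) + l * q y" "q (y - 1) \<le> l * q (x - 1) + (1 - l) * q y"
    using convex_onD[OF assms, of l "x - 1" y] convex_onD[OF assms, of "1 - l" "x - 1" y] l
    by auto
  then show "backward_diff q x \<le> backward_diff q y"
    by (simp add: backward_diff_def algebra_simps)
qed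

lemma convex_on_smooth_ramp: "convex_on UNIV (smooth_ramp m)"
proof (induction m)
  case 0
  show ?case using convex_on_trunc_power[of 0] by (simp add: smooth_ramp_def)
next
  case (Suc m)
  show ?case
  proof (rule convex_on_realI[OF _ smooth_ramp_deriv])
    fix x y :: real assume "x \<le> y"
    then show "backward_diff (smooth_ramp m) x \<le> backward_diff (smooth_ramp m) y"
      by (rule monoD[OF mono_backward_diff[OF Suc]])
  qed auto
qed

text \<open>Each averaging step widens the transition zone by the step length one, so the zone is
\<open>[0, m]\<close>; beyond it the slope is one.\<close>
lemma smooth_ramp_eventually_affine:
  "real m \<le> t \<Longrightarrow> smooth_ramp m t = t - (real m - smooth_ramp m (real m))"
proof (induction m arbitrary: t)
  case 0
  then show ?case by (auto simp: smooth_ramp_def trunc_power_def)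
next
  case (Suc m)
  have "\<exists>c. \<forall>x\<in>{real (Suc m)..}. smooth_ramp (Suc m) x - x = c"
  proof (rule has_field_derivative_zero_constant)
    fix x assume x: "x \<in> {real (Suc m)..}"
    have "backward_diff (smooth_ramp m) x = 1"
      using Suc.IH[of x] Suc.IH[of "x - 1"] x by (simp add: backward_diff_def)
    then show "((\<lambda>x. smooth_ramp (Suc m) x - x) has_real_derivative 0)
        (at x within {real (Suc m)..})"
      by (auto intro!: derivative_eq_intros has_field_derivative_at_within[OF smooth_ramp_deriv])
  qed auto
  then obtain c where "\<And>x. real (Suc m) \<le> x \<Longrightarrow> smooth_ramp (Suc m) x - x = c"
    by auto
  from this[OF Suc.prems] this[of "real (Suc m)"] show ?case by simp
qed


section \<open>Local midpoint convexity\<close>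

text \<open>Subtract from \<open>F\<close> its chord along a segment. If the difference \<open>q\<close> were positive somewhere, it would
attain a positive maximum, and at the leftmost maximum point the midpoint inequality fails: nearby
values are at most the maximum on the right and strictly smaller on the left. Stating the
hypothesis at the single centre \<open>z\<close>, rather than as convexity near \<open>z\<close>, allows it to be
verified at points that lie on the seam of a gluing.\<close>
lemma convex_on_if_locally_midpoint_convex:
  fixes F :: "'a::real_normed_vector \<Rightarrow> real"
  assumes cont: "continuous_on UNIV F"
    and loc: "\<And>z. \<exists>d>0. \<forall>u. norm u < d \<longrightarrow> 2 * F z \<le> F (z + u) + F (z - u)"
  shows "convex_on UNIV F"
proof (rule convex_onI)
  fix s :: real and x y :: 'a
  assume s: "0 < s" "s < 1"
  define p where "p t = x + t *\<^sub>R (y - x)" for t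
  define q where "q t = F (p t) - ((1 - t) * F x + t * F y)" for t
  have q01: "q 0 = 0" "q 1 = 0" by (simp_all add: q_def p_def)
  have cq: "continuous_on {0..1} q"
    unfolding q_def p_def
    by (intro continuous_intros continuous_on_compose2[OF cont]) auto
  have "q s \<le> 0"
  proof (rule ccontr)
    assume "\<not> q s \<le> 0"
    obtain t1 where t1: "t1 \<in> {0..1}" and max: "\<And>t. t \<in> {0..1} \<Longrightarrow> q t \<le> q t1"
      using continuous_attains_sup[OF _ _ cq] by auto
    let ?T = "{t \<in> {0..1}. q t = q t1}"
    have "closed ?T"
      using continuous_closed_preimage_constant[OF cq] by simp
    moreover have "bounded ?T"
      by (rule bounded_subset[OF bounded_closed_interval[of 0 1]]) auto
    ultimately have "compact ?T"
      by (simp add: compact_eq_bounded_closed)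
    then obtain t0 where t0: "t0 \<in> ?T" and least: "\<And>t. t \<in> ?T \<Longrightarrow> t0 \<le> t"
      using compact_attains_inf[of ?T] t1 by blast
    have "0 < q t0"
      using \<open>\<not> q s \<le> 0\<close> max[of s] s t0 by auto
    then have "0 < t0" "t0 < 1"
      using t0 q01 by (auto simp: less_le)
    obtain d where "d > 0" and d: "\<And>u. norm u < d \<Longrightarrow> 2 * F (p t0) \<le> F (p t0 + u) + F (p t0 - u)"
      using loc[of "p t0"] by auto
    \<comment> \<open>A step \<open>e\<close> that stays inside \<open>[0, 1]\<close> and moves the point by less than \<open>d\<close>; the added \<open>1\<close> in \<open>b\<close>
      covers the case \<open>x = y\<close>.\<close>
    define b where "b = d / (norm (y - x) + 1)"
    have "b > 0"
      using \<open>d > 0\<close> by (simp add: b_def add_nonneg_pos)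
    define e where "e = min (min t0 (1 - t0)) (b / 2)"
    have e: "0 < e" "e \<le> t0" "e \<le> 1 - t0" and "e < b"
      using \<open>b > 0\<close> \<open>0 < t0\<close> \<open>t0 < 1\<close> by (auto simp: e_def)
    then have "e * (norm (y - x) + 1) < d"
      by (simp add: b_def pos_less_divide_eq add_nonneg_pos)
    then have "norm (e *\<^sub>R (y - x)) < d"
      using e(1) by (simp add: distrib_left)
    from d[OF this] have "2 * F (p t0) \<le> F (p (t0 + e)) + F (p (t0 - e))"
      by (simp add: p_def algebra_simps)
    then have "2 * q t0 \<le> q (t0 + e) + q (t0 - e)"
      by (simp add: q_def algebra_simps)
    moreover have "q (t0 + e) \<le> q t0"
      using max[of "t0 + e"] e t0 by auto
    moreover have "q (t0 - e) < q t0"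
      using max[of "t0 - e"] least[of "t0 - e"] e t0 by fastforce
    ultimately show False by simp
  qed
  then show "F ((1 - s) *\<^sub>R x + s *\<^sub>R y) \<le> (1 - s) * F x + s * F y"
    by (simp add: q_def p_def algebra_simps)
qed auto

lemma midpoint_convex:
  fixes f :: "'a::real_vector \<Rightarrow> real"
  assumes "convex_on U f" "z + u \<in> U" "z - u \<in> U"
  shows "2 * f z \<le> f (z + u) + f (z - u)"
proof -
  have "(1/2) *\<^sub>R (z + u) + (1/2) *\<^sub>R (z - u) = z"
    by (simp add: algebra_simps flip: scaleR_add_left)
  then show ?thesis
    using convex_onD[OF assms(1), of "1/2" "z + u" "z - u"] assms(2,3) by simp
qed

section \<open>Gluing two convex functions\<close>

text \<open>The smoothed maximum \<open>(x, y) \<mapsto> x + h (y - x)\<close> is nondecreasing in \<open>y\<close> because \<open>h\<close> is, nondecreasing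
in \<open>x\<close> because the slope of \<open>h\<close> is at most one, and convex because \<open>h\<close> is; so it preserves midpoint
inequalities.\<close>
lemma smooth_ramp_glue_midpoint:
  assumes "2 * a \<le> a1 + a2" "2 * b \<le> b1 + b2"
  shows "2 * (a + smooth_ramp m (b - a))
    \<le> (a1 + smooth_ramp m (b1 - a1)) + (a2 + smooth_ramp m (b2 - a2))"
proof -
  define a' b' where "a' = (a1 + a2) / 2" and "b' = (b1 + b2) / 2"
  have "a + smooth_ramp m (b - a) \<le> a + smooth_ramp m (b' - a)"
    using smooth_ramp_mono_and_lipschitz[of "b - a" "b' - a" m] assms by (simp add: b'_def)
  also have "\<dots> \<le> a' + smooth_ramp m (b' - a')"
    using smooth_ramp_mono_and_lipschitz[of "b' - a'" "b' - a" m] assms by (simp add: a'_def)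
  finally have "2 * (a + smooth_ramp m (b - a)) \<le> 2 * a' + 2 * smooth_ramp m (b' - a')"
    by simp
  also have "2 * smooth_ramp m (b' - a') \<le> smooth_ramp m (b1 - a1) + smooth_ramp m (b2 - a2)"
  proof -
    let ?u = "((b1 - a1) - (b2 - a2)) / 2"
    have "b' - a' + ?u = b1 - a1" "b' - a' - ?u = b2 - a2"
      by (simp_all add: a'_def b'_def field_simps)
    then show ?thesis
      using midpoint_convex[OF convex_on_smooth_ramp[of m], of "b' - a'" ?u] by simp
  qed
  finally have "2 * (a + smooth_ramp m (b - a))
      \<le> 2 * a' + (smooth_ramp m (b1 - a1) + smooth_ramp m (b2 - a2))" by simp
  moreover have "2 * a' = a1 + a2" by (simp add: a'_def)
  ultimately show ?thesis by linarith
qed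

text \<open>With slope at most one, the ramp cannot have been below the line that it finally follows. This
makes the smoothed maximum of \<open>f\<close> and \<open>g\<close> dominate \<open>g - c\<close> everywhere.\<close>
lemma smooth_ramp_ge_asymptote:
  "t - (real m - smooth_ramp m (real m)) \<le> smooth_ramp m t"
proof (cases "real m \<le> t")
  case True
  then show ?thesis using smooth_ramp_eventually_affine[OF True] by linarith
next
  case False
  then show ?thesis using smooth_ramp_mono_and_lipschitz[of t "real m" m] by simp
qed

text \<open>On \<open>V\<close> take the smoothed maximum \<open>M\<close>, elsewhere \<open>g - c\<close>. Both agree near the frontier of \<open>V\<close>, where
\<open>g - f\<close> exceeds \<open>m\<close> and the ramp is affine; hence the result is smooth.\<close>
lemma convex_gluing:
  fixes f g :: "'a::euclidean_space \<Rightarrow> real"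
  assumes "open U" "Ck_on m f U" "convex_on U f"
    and "Ck_on m g UNIV" "convex_on UNIV g"
    and "open V" "closure V \<subseteq> U"
    and large: "\<And>x. x \<in> frontier V \<Longrightarrow> real m < g x - f x"
  obtains F where "convex_on UNIV F" "Ck_on m F UNIV"
    "\<And>x. x \<in> V \<Longrightarrow> g x \<le> f x \<Longrightarrow> F x = f x"
proof -
  define c where "c = real m - smooth_ramp m (real m)"
  define M where "M x = f x + smooth_ramp m (g x - f x)" for x
  define F where "F x = (if x \<in> V then M x else g x - c)" for x
  \<comment> \<open>The overlap region of the two formulas; with \<open>V\<close> and the exterior of \<open>V\<close> it covers the space.\<close>
  define W where "W = {x \<in> U. real m < g x - f x}"
  have gU: "Ck_on m g U" by (rule Ck_on_subset[OF assms(4)]) auto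
  have VU: "V \<subseteq> U" using assms(7) closure_subset by blast
  have gf: "Ck_on m (\<lambda>x. g x - f x) U"
    by (rule Ck_on_diff[OF \<open>open U\<close> gU assms(2)])
  have "open W"
    using continuous_open_preimage[OF Ck_on_imp_continuous_on[OF gf] \<open>open U\<close>, of "{real m<..}"]
    by (simp add: W_def vimage_def Int_def)
  have M_W: "M x = g x - c" if "x \<in> W" for x
    using that smooth_ramp_eventually_affine[of m "g x - f x"] by (simp add: M_def W_def c_def)
  have M_ge: "g x - c \<le> M x" for x
    using smooth_ramp_ge_asymptote[of "g x - f x" m] by (simp add: M_def c_def)
  have "Ck_on m M U"
    unfolding M_def by (rule Ck_on_add[OF \<open>open U\<close> assms(2) Ck_on_compose[OF \<open>open U\<close> Ck_on_smooth_ramp gf]])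
  then have "Ck_on m M V"
    by (rule Ck_on_subset[OF _ VU \<open>open U\<close>])
  then have F_V: "Ck_on m F V"
    using Ck_on_cong[OF \<open>open V\<close>, of F M m] by (simp add: F_def)
  have op: "open (W \<union> - closure V)" using \<open>open W\<close> by auto
  have "Ck_on m (\<lambda>x. g x - c) (W \<union> - closure V)"
    by (intro Ck_on_diff Ck_on_const op Ck_on_subset[OF assms(4)]) auto
  moreover have "F x = g x - c" if "x \<in> W \<union> - closure V" for x
    using that M_W closure_subset by (auto simp: F_def)
  ultimately have F_W: "Ck_on m F (W \<union> - closure V)"
    using Ck_on_cong[OF op, of F "\<lambda>x. g x - c" m] by simp
  have "V \<union> (W \<union> - closure V) = UNIV"
    using large assms(7) \<open>open V\<close> by (auto simp: W_def frontier_def interior_open)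
  then have F_Ck: "Ck_on m F UNIV"
    using Ck_on_Un[OF F_V F_W \<open>open V\<close> op] by simp
  show ?thesis
  proof (rule that[OF _ F_Ck])
    show "convex_on UNIV F"
    proof (rule convex_on_if_locally_midpoint_convex[OF Ck_on_imp_continuous_on[OF F_Ck]])
      fix z
      have g_mid: "2 * g z \<le> g (z + u) + g (z - u)" for u
        using midpoint_convex[OF assms(5)] by simp
      show "\<exists>d>0. \<forall>u. norm u < d \<longrightarrow> 2 * F z \<le> F (z + u) + F (z - u)"
      proof (cases "z \<in> V")
        case True
        then obtain d where "d > 0" and d: "ball z d \<subseteq> V"
          using \<open>open V\<close> open_contains_ball by blast
        have "2 * F z \<le> F (z + u) + F (z - u)" if "norm u < d" for u
        proof -
          have V: "z + u \<in> V" "z - u \<in> V"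
            using d that by (auto simp: subset_iff dist_norm)
          then have "2 * f z \<le> f (z + u) + f (z - u)"
            using VU by (intro midpoint_convex[OF assms(3)]) auto
          from smooth_ramp_glue_midpoint[OF this g_mid] show ?thesis
            using True V by (simp add: F_def M_def)
        qed
        then show ?thesis using \<open>d > 0\<close> by blast
      next
        case False
        \<comment> \<open>Here \<open>F\<close> touches from above the convex function \<open>g - c\<close>, whose midpoint inequality it inherits.\<close>
        have "g x - c \<le> F x" for x
          using M_ge by (simp add: F_def)
        from this[of "z + u" for u] this[of "z - u" for u] g_mid
        have "2 * F z \<le> F (z + u) + F (z - u)" for u
          using False by (smt (verit) F_def)
        then show ?thesis by (intro exI[of _ 1]) auto
      qed
    qed
    show "F x = f x" if "x \<in> V" "g x \<le> f x" for x
      using that smooth_ramp_eq_0 by (simp add: F_def M_def)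
  qed
qed

section \<open>The dominating convex function and the extension\<close>

lemma convex_on_sum_fun:
  assumes "\<And>i. i \<in> I \<Longrightarrow> convex_on S (f i)" "convex S"
  shows "convex_on S (\<lambda>x. \<Sum>i\<in>I. f i x :: real)"
  using assms(1)
  by (induction I rule: infinite_finite_induct) (auto intro: convex_on_add simp: assms(2) convex_on_const)

text \<open>Each point of \<open>S\<close> lies in an open half-space \<open>a \<bullet> x < b\<close> that misses \<open>K\<close>. Finitely many of these cover
\<open>S\<close>, and the truncated power of \<open>b - a \<bullet> x\<close> is positive exactly on the half-space.\<close>
lemma smooth_convex_vanishing_on_convex_pos_on_compact:
  fixes K S :: "'a::euclidean_space set"
  assumes "convex K" "closed K" "compact S" "K \<inter> S = {}"
  obtains \<phi> :: "'a \<Rightarrow> real" where "convex_on UNIV \<phi>" "Ck_on m \<phi> UNIV"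
    "\<And>x. x \<in> K \<Longrightarrow> \<phi> x = 0" "\<And>x. x \<in> S \<Longrightarrow> 0 < \<phi> x"
proof -
  define P where "P = {(a, b). \<forall>x\<in>K. b < inner a x}"
  define H where "H = (\<lambda>(a::'a, b). {x. inner a x < b})"
  have "S \<subseteq> (\<Union>i\<in>P. H i)"
  proof
    fix z assume "z \<in> S"
    then have "z \<notin> K" using assms(4) by auto
    then obtain a b where "inner a z < b" "\<forall>x\<in>K. inner a x > b"
      using separating_hyperplane_closed_point[OF assms(1,2)] by blast
    then show "z \<in> (\<Union>i\<in>P. H i)"
      by (auto simp: P_def H_def intro!: bexI[of _ "(a, b)"])
  qed
  moreover have "open (H i)" for i
    by (auto simp: H_def open_halfspace_lt split: prod.split)
  ultimately obtain Q where Q: "Q \<subseteq> P" "finite Q" "S \<subseteq> (\<Union>i\<in>Q. H i)"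
    using compactE_image[OF assms(3), of P H] by metis
  define \<theta> where "\<theta> i x = trunc_power (Suc m) (snd i - inner (fst i) x)" for i :: "'a \<times> real" and x
  have \<theta>_nonneg: "0 \<le> \<theta> i x" for i x
    by (simp add: \<theta>_def trunc_power_def)
  show ?thesis
  proof (rule that[of "\<lambda>x. \<Sum>i\<in>Q. \<theta> i x"])
    have "convex_on UNIV (\<theta> i)" for i
    proof (rule convex_onI)
      fix t :: real and x y :: 'a assume "0 < t" "t < 1"
      moreover have "snd i - inner (fst i) ((1 - t) *\<^sub>R x + t *\<^sub>R y)
          = (1 - t) *\<^sub>R (snd i - inner (fst i) x) + t *\<^sub>R (snd i - inner (fst i) y)"
        by (simp add: inner_add_right algebra_simps)
      ultimately show "\<theta> i ((1 - t) *\<^sub>R x + t *\<^sub>R y) \<le> (1 - t) * \<theta> i x + t * \<theta> i y"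
        unfolding \<theta>_def by (simp only: convex_onD[OF convex_on_trunc_power] less_imp_le UNIV_I)
    qed auto
    then show "convex_on UNIV (\<lambda>x. \<Sum>i\<in>Q. \<theta> i x)"
      by (intro convex_on_sum_fun) auto
    show "Ck_on m (\<lambda>x. \<Sum>i\<in>Q. \<theta> i x) UNIV"
      unfolding \<theta>_def
      by (intro Ck_on_sum Ck_on_compose[OF _ Ck_on_trunc_power] Ck_on_diff Ck_on_const
          Ck_on_bounded_linear bounded_linear_inner_right open_UNIV)
    show "(\<Sum>i\<in>Q. \<theta> i x) = 0" if "x \<in> K" for x
    proof (rule sum.neutral, rule ballI)
      fix i assume "i \<in> Q"
      then have "snd i < inner (fst i) x" using Q(1) that by (auto simp: P_def)
      then show "\<theta> i x = 0" by (simp add: \<theta>_def trunc_power_def)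
    qed
    show "0 < (\<Sum>i\<in>Q. \<theta> i x)" if xS: "x \<in> S" for x
    proof -
      obtain i where "i \<in> Q" "x \<in> H i" using Q(3) xS by blast
      then have "0 < \<theta> i x" by (auto simp: \<theta>_def H_def trunc_power_def)
      then show ?thesis
        by (intro sum_pos2[OF Q(2) \<open>i \<in> Q\<close>]) (auto simp: \<theta>_nonneg)
    qed
  qed
qed

theorem proposition1p5:
  fixes m :: nat and C U :: "(real ^ 'n) set" and f :: "real ^ 'n \<Rightarrow> real"
  assumes "1 \<le> m"
    and "compact C"
    and "open U" and "convex U" and "C \<subseteq> U"
    and "Ck_on m f U"
    and "convex_on U f"
  shows "\<exists>F :: real ^ 'n \<Rightarrow> real.
           convex_on UNIV F \<and> Ck_on m F UNIV \<and> (\<forall>x\<in>C. F x = f x)"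
proof -
  define K where "K = convex hull C"
  have "compact K" "convex K" "K \<subseteq> U" "C \<subseteq> K"
    using assms by (auto simp: K_def compact_convex_hull hull_subset hull_minimal)
  obtain e where "e > 0" and e: "(\<Union>x\<in>K. cball x e) \<subseteq> U"
    using compact_subset_open_imp_cball_epsilon_subset[OF \<open>compact K\<close> \<open>open U\<close> \<open>K \<subseteq> U\<close>] by blast
  define V where "V = (\<Union>x\<in>K. ball x e)"
  have "open V" "K \<subseteq> V"
    using \<open>e > 0\<close> by (auto simp: V_def)
  have "compact (\<Union>x\<in>K. cball x e)"
    using \<open>compact K\<close> by (rule compact_minkowski_sum_cball)
  then have "closure V \<subseteq> (\<Union>x\<in>K. cball x e)"
    by (intro closure_minimal compact_imp_closed) (auto simp: V_def less_imp_le)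
  then have "closure V \<subseteq> U" "compact (closure V)"
    using e compact_Int_closed[OF \<open>compact (\<Union>x\<in>K. cball x e)\<close> closed_closure, of V]
    by (auto simp: Int_absorb1 simp del: compact_closure)
  define S where "S = frontier V"
  have "compact S" "S \<subseteq> closure V" "K \<inter> S = {}"
    using \<open>compact (closure V)\<close> \<open>K \<subseteq> V\<close> \<open>open V\<close>
    by (auto simp: S_def frontier_def interior_open compact_diff)
  obtain \<phi> where \<phi>: "convex_on UNIV \<phi>" "Ck_on m \<phi> UNIV"
      "\<And>x. x \<in> K \<Longrightarrow> \<phi> x = 0" "\<And>x. x \<in> S \<Longrightarrow> 0 < \<phi> x"
    using smooth_convex_vanishing_on_convex_pos_on_compact
      [OF \<open>convex K\<close> compact_imp_closed[OF \<open>compact K\<close>] \<open>compact S\<close> \<open>K \<inter> S = {}\<close>] by metis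
  have "continuous_on (closure V) f"
    using Ck_on_imp_continuous_on[OF assms(6)] \<open>closure V \<subseteq> U\<close> continuous_on_subset by blast
  then have "bounded (f ` closure V)"
    using \<open>compact (closure V)\<close> compact_continuous_image compact_imp_bounded by blast
  then obtain B where B: "\<And>x. x \<in> closure V \<Longrightarrow> \<bar>f x\<bar> \<le> B"
    by (auto simp: bounded_iff)
  obtain \<eta> where "\<eta> > 0" and \<eta>: "\<And>x. x \<in> S \<Longrightarrow> \<eta> \<le> \<phi> x"
  proof (cases "S = {}")
    case False
    have "continuous_on S \<phi>"
      using Ck_on_imp_continuous_on[OF \<phi>(2)] continuous_on_subset by blast
    then obtain z where "z \<in> S" "\<And>x. x \<in> S \<Longrightarrow> \<phi> z \<le> \<phi> x"
      using continuous_attains_inf[OF \<open>compact S\<close> False] by blast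
    then show ?thesis using that[of "\<phi> z"] \<phi>(4) by blast
  qed (use that[of 1] in auto)
  \<comment> \<open>On \<open>K\<close> we need \<open>-\<bar>B\<bar> \<le> f\<close>; on the frontier \<open>A * \<eta> - \<bar>B\<bar>\<close> must exceed \<open>f + m\<close>, and \<open>f\<close> is at most \<open>\<bar>B\<bar>\<close>.
    The absolute value keeps \<open>A\<close> nonnegative even if \<open>closure V\<close> is empty and \<open>B\<close> is arbitrary.\<close>
  define A where "A = (2 * \<bar>B\<bar> + real m + 1) / \<eta>"
  have "A \<ge> 0" "A * \<eta> = 2 * \<bar>B\<bar> + real m + 1"
    using \<open>\<eta> > 0\<close> by (auto simp: A_def)
  define g where "g x = A * \<phi> x - \<bar>B\<bar>" for x
  have "Ck_on m g UNIV"
    unfolding g_def by (intro Ck_on_diff Ck_on_cmult Ck_on_const \<phi> open_UNIV)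
  have "convex_on UNIV g"
    using convex_on_add[OF convex_on_cmul[OF \<open>A \<ge> 0\<close> \<phi>(1)], of "\<lambda>_. - \<bar>B\<bar>"]
    by (simp add: g_def[abs_def] convex_on_const)
  have large: "real m < g x - f x" if "x \<in> frontier V" for x
  proof -
    have "A * \<eta> \<le> A * \<phi> x"
      using \<eta> that \<open>A \<ge> 0\<close> by (intro mult_left_mono) (auto simp: S_def)
    moreover have "f x \<le> \<bar>B\<bar>"
      using B[of x] that \<open>S \<subseteq> closure V\<close> by (auto simp: S_def)
    ultimately show ?thesis
      using \<open>A * \<eta> = _\<close> by (simp add: g_def)
  qed
  obtain F where "convex_on UNIV F" "Ck_on m F UNIV"
    and F: "\<And>x. x \<in> V \<Longrightarrow> g x \<le> f x \<Longrightarrow> F x = f x"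
    using convex_gluing[OF \<open>open U\<close> assms(6,7) \<open>Ck_on m g UNIV\<close> \<open>convex_on UNIV g\<close>
        \<open>open V\<close> \<open>closure V \<subseteq> U\<close> large] by metis
  moreover have "F x = f x" if "x \<in> C" for x
  proof (rule F)
    have "x \<in> K" using that \<open>C \<subseteq> K\<close> by auto
    then show "x \<in> V" using \<open>K \<subseteq> V\<close> by auto
    then have "\<bar>f x\<bar> \<le> B" using B closure_subset by blast
    then show "g x \<le> f x" using \<phi>(3)[OF \<open>x \<in> K\<close>] by (simp add: g_def)
  qed
  ultimately show ?thesis by blast
qed

end
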